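(* Let $\mathcal{E}: M_d(\mathbb{C})\to M_d(\mathbb{C})$ be a quantum channel with Kraus operators $A_1,\dots,A_\kappa$. If $A_1,\dots,A_\kappa$ have at least two common eigenstates, i.e. there are two unit vectors $|\psi\rangle,|\varphi\rangle\in\mathbb{C}^d$, not scalar multiples of each other, and scalars $\lambda_i,\mu_i\in\mathbb{C}$ with $A_i|\psi\rangle=\lambda_i|\psi\rangle$ and $A_i|\varphi\rangle=\mu_i|\varphi\rangle$ for every $i=1,\dots,\kappa$, then the zero-error capacity of $\mathcal{E}$ is positive: $C^{(0)}(\mathcal{E})>0$.
   Context: Logarithms are in base 2. A quantum channel on $\mathcal{H}\cong\mathbb{C}^d$ is a completely positive trace-preserving linear map $\mathcal{E}(\rho)=\sum_{i=1}^{\kappa}A_i\rho A_i^\dagger$ with Kraus operators $A_i\in M_d(\mathbb{C})$ satisfying $\sum_{i=1}^{\kappa}A_i^\dagger A_i=\mathbb{I}$ and $\kappa\le d^2$. Zero-error codes: let $\mathcal{S}=\{\rho_1,\dots,\rho_\ell\}$ be a finite set of input states (density operators on $\mathcal{H}$; a pure state $|\psi\rangle$ is identified with $|\psi\rangle\langle\psi|$). Let $\mathcal{S}^{\otimes n}$ be the set of tensor products $\rho_{i_1}\otimes\cdots\otimes\rho_{i_n}$ with each $\rho_{i_j}\in\mathcal{S}$. An $(m,n)$ quantum zero-error code for $\mathcal{E}$ with alphabet $\mathcal{S}$ consists of: (1) a message set $\{1,\dots,m\}$; (2) an encoding function $f_n:\{1,\dots,m\}\to\mathcal{S}^{\otimes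 n}$; (3) a POVM $\{M_j\}_{j=1}^{k}$ on $\mathcal{H}^{\otimes n}$ (positive semidefinite operators with $\sum_j M_j=\mathbb{I}$) and a decoding function $g:\{1,\dots,k\}\to\{1,\dots,m\}$. When message $i$ is sent, outcome $j$ occurs with probability $p(j|i)=\mathrm{tr}[\mathcal{E}^{\otimes n}(f_n(i))M_j]$ (memoryless use of the channel), and it is required that the decoded message $g(j)$ differs from $i$ with probability $0$, for every $i\in\{1,\dots,m\}$. The rate of the code is $\frac1n\log m$. The zero-error capacity is $C^{(0)}(\mathcal{E})=\sup_{\mathcal{S}}\sup_n\frac1n\log m$, where $m$ is the maximum number of messages in a zero-error $(m,n)$ code with alphabet $\mathcal{S}$, and the supremum runs over finite sets $\mathcal{S}$ of input states and over $n\ge 1$. *)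

theory Defs
  imports
    Complex_Main
    "HOL-Library.Extended_Real"
    "Jordan_Normal_Form.Schur_Decomposition"
begin

type_synonym cmat = "complex mat"
type_synonym cvec = "complex vec"

definition mat_trace :: "cmat \<Rightarrow> complex" where
  "mat_trace X = (\<Sum>i<dim_row X. X $$ (i, i))"

(* Matrices of all sizes share one type, which therefore has no zero; so a finite sum of
   n x n matrices is formed entrywise. *)
definition sum_of_mats :: "nat \<Rightarrow> ('i \<Rightarrow> cmat) \<Rightarrow> 'i set \<Rightarrow> cmat" where
  "sum_of_mats n F I = mat n n (\<lambda>(r, c). \<Sum>i\<in>I. F i $$ (r, c))"

(* On complex numbers, 0 \<le> z means that z is real and nonnegative, so the condition
   includes that X is Hermitian. *)
definition pos_semidef :: "nat \<Rightarrow> cmat \<Rightarrow> bool" where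
  "pos_semidef n X \<longleftrightarrow> X \<in> carrier_mat n n \<and> (\<forall>v\<in>carrier_vec n. 0 \<le> (X *\<^sub>v v) \<bullet>c v)"

definition density_ops :: "nat \<Rightarrow> cmat set" where
  "density_ops n = {\<rho>. pos_semidef n \<rho> \<and> mat_trace \<rho> = 1}"

definition povm :: "nat \<Rightarrow> nat \<Rightarrow> (nat \<Rightarrow> cmat) \<Rightarrow> bool" where
  "povm n k M \<longleftrightarrow> (\<forall>j\<in>{1..k}. pos_semidef n (M j)) \<and> sum_of_mats n M {1..k} = 1\<^sub>m n"

definition quantum_channel ::
  "nat \<Rightarrow> (cmat \<Rightarrow> cmat) \<Rightarrow> nat \<Rightarrow> (nat \<Rightarrow> cmat) \<Rightarrow> bool" where
  "quantum_channel d E \<kappa> A \<longleftrightarrow>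
     \<kappa> \<le> d\<^sup>2 \<and>
     (\<forall>i\<in>{1..\<kappa>}. A i \<in> carrier_mat d d) \<and>
     sum_of_mats d (\<lambda>i. mat_adjoint (A i) * A i) {1..\<kappa>} = 1\<^sub>m d \<and>
     (\<forall>\<rho>\<in>carrier_mat d d. E \<rho> = sum_of_mats d (\<lambda>i. A i * \<rho> * mat_adjoint (A i)) {1..\<kappa>})"

(* Kronecker product; the n-fold tensor power of C^d is C^(d^n). *)
definition kron :: "cmat \<Rightarrow> cmat \<Rightarrow> cmat" where
  "kron X Y = mat (dim_row X * dim_row Y) (dim_col X * dim_col Y)
     (\<lambda>(i, j). X $$ (i div dim_row Y, j div dim_col Y) * Y $$ (i mod dim_row Y, j mod dim_col Y))"

fun kron_list :: "cmat list \<Rightarrow> cmat" where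
  "kron_list [] = 1\<^sub>m 1"
| "kron_list (X # Xs) = kron X (kron_list Xs)"

definition mat_unit :: "nat \<Rightarrow> nat \<Rightarrow> nat \<Rightarrow> cmat" where
  "mat_unit d a b = mat d d (\<lambda>(i, j). if i = a \<and> j = b then 1 else 0)"

definition mat_block :: "nat \<Rightarrow> nat \<Rightarrow> nat \<Rightarrow> cmat \<Rightarrow> cmat" where
  "mat_block D a b X = mat D D (\<lambda>(i, j). X $$ (a * D + i, b * D + j))"

(* The n-th tensor power of the linear map E. With e_ab the matrix units of M_d, every
   matrix X of size d^(n+1) is the sum over a, b of e_ab tensor X_ab, where X_ab is the
   (a,b) block of X; by linearity its image is the sum of E(e_ab) tensor E^n(X_ab). *)
primrec channel_power :: "nat \<Rightarrow> (cmat \<Rightarrow> cmat) \<Rightarrow> nat \<Rightarrow> cmat \<Rightarrow> cmat" where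
  "channel_power d E 0 X = X"
| "channel_power d E (Suc n) X =
     sum_of_mats (d ^ Suc n)
       (\<lambda>(a, b). kron (E (mat_unit d a b)) (channel_power d E n (mat_block (d ^ n) a b X)))
       ({..<d} \<times> {..<d})"

definition tensor_states :: "cmat set \<Rightarrow> nat \<Rightarrow> cmat set" where
  "tensor_states S n = {kron_list \<rho>s |\<rho>s. length \<rho>s = n \<and> set \<rho>s \<subseteq> S}"

definition outcome_prob ::
  "nat \<Rightarrow> (cmat \<Rightarrow> cmat) \<Rightarrow> nat \<Rightarrow> (nat \<Rightarrow> cmat) \<Rightarrow> (nat \<Rightarrow> cmat) \<Rightarrow> nat \<Rightarrow> nat \<Rightarrow> complex" where
  "outcome_prob d E n f M j i = mat_trace (channel_power d E n (f i) * M j)"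

definition zero_error_code ::
  "nat \<Rightarrow> (cmat \<Rightarrow> cmat) \<Rightarrow> cmat set \<Rightarrow> nat \<Rightarrow> nat \<Rightarrow>
   (nat \<Rightarrow> cmat) \<Rightarrow> nat \<Rightarrow> (nat \<Rightarrow> cmat) \<Rightarrow> (nat \<Rightarrow> nat) \<Rightarrow> bool" where
  "zero_error_code d E S m n f k M g \<longleftrightarrow>
     (\<forall>i\<in>{1..m}. f i \<in> tensor_states S n) \<and>
     povm (d ^ n) k M \<and>
     (\<forall>j\<in>{1..k}. g j \<in> {1..m}) \<and>
     (\<forall>i\<in>{1..m}. (\<Sum>j\<in>{j \<in> {1..k}. g j \<noteq> i}. outcome_prob d E n f M j i) = 0)"

(* For a channel E, d \<ge> 1 and a finite nonempty alphabet S the maximum is over a finite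
   nonempty set: m = 1 is always achieved, and a zero-error encoding is injective into the
   finite set of tensor states (equal states would give equal outcome probabilities, which
   sum to 1), so m is at most card S ^ n. *)
definition max_messages :: "nat \<Rightarrow> (cmat \<Rightarrow> cmat) \<Rightarrow> cmat set \<Rightarrow> nat \<Rightarrow> nat" where
  "max_messages d E S n = Max {m. \<exists>f k M g. zero_error_code d E S m n f k M g}"

(* Suprema in ereal, so that they are meaningful without a boundedness proof. *)
definition zero_error_capacity :: "nat \<Rightarrow> (cmat \<Rightarrow> cmat) \<Rightarrow> ereal" where
  "zero_error_capacity d E =
     (SUP S \<in> {S. finite S \<and> S \<noteq> {} \<and> S \<subseteq> density_ops d}.
        SUP n \<in> {1..}. ereal (1 / real n * log 2 (real (max_messages d E S n))))"


(* The defining property of the tensor power: it acts factorwise on tensor products. *)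

lemma channel_power_carrier:
  assumes "X \<in> carrier_mat (d ^ n) (d ^ n)"
  shows "channel_power d E n X \<in> carrier_mat (d ^ n) (d ^ n)"
  using assms by (cases n) (auto simp: sum_of_mats_def)

lemma quantum_channel_carrier:
  assumes "quantum_channel d E \<kappa> A" "X \<in> carrier_mat d d"
  shows "E X \<in> carrier_mat d d"
  using assms by (auto simp: quantum_channel_def sum_of_mats_def)

lemma mat_adjoint_index:
  assumes "X \<in> carrier_mat d d" "i < d" "j < d"
  shows "mat_adjoint X $$ (i, j) = cnj (X $$ (j, i))"
  using assms by (auto simp: mat_adjoint_def mat_of_rows_def)

lemma quantum_channel_index:
  assumes q: "quantum_channel d E \<kappa> A" and X: "X \<in> carrier_mat d d" and r: "r < d" and c: "c < d"
  shows "E X $$ (r, c) = (\<Sum>(a, b)\<in>{..<d} \<times> {..<d}. X $$ (a, b) * E (mat_unit d a b) $$ (r, c))"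
proof -
  have A: "A i \<in> carrier_mat d d" if "i \<in> {1..\<kappa>}" for i
    using q that by (auto simp: quantum_channel_def)
  have entry: "(A i * Y * mat_adjoint (A i)) $$ (r, c) =
      (\<Sum>(a, b)\<in>{..<d} \<times> {..<d}. A i $$ (r, a) * Y $$ (a, b) * cnj (A i $$ (c, b)))"
    if i: "i \<in> {1..\<kappa>}" and Y: "Y \<in> carrier_mat d d" for i Y
  proof -
    have adj: "mat_adjoint (A i) \<in> carrier_mat d d"
      using A[OF i] by (auto simp: mat_adjoint_def)
    have "(A i * Y * mat_adjoint (A i)) $$ (r, c) =
       (\<Sum>a<d. A i $$ (r, a) * (\<Sum>b<d. Y $$ (a, b) * cnj (A i $$ (c, b))))"
      using A[OF i] Y adj r c
      by (auto simp: scalar_prod_def mat_adjoint_index[OF A[OF i]] atLeast0LessThan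
               intro!: sum.cong)
    also have "\<dots> = (\<Sum>a<d. \<Sum>b<d. A i $$ (r, a) * Y $$ (a, b) * cnj (A i $$ (c, b)))"
      by (simp add: sum_distrib_left mult.assoc)
    finally show ?thesis by (simp add: sum.cartesian_product)
  qed
  have E: "E Y $$ (r, c) = (\<Sum>i\<in>{1..\<kappa>}.
      \<Sum>(a, b)\<in>{..<d} \<times> {..<d}. A i $$ (r, a) * Y $$ (a, b) * cnj (A i $$ (c, b)))"
    if Y: "Y \<in> carrier_mat d d" for Y
  proof -
    have "E Y $$ (r, c) = (\<Sum>i\<in>{1..\<kappa>}. (A i * Y * mat_adjoint (A i)) $$ (r, c))"
      using q Y r c unfolding quantum_channel_def sum_of_mats_def by simp
    then show ?thesis using entry[OF _ Y] by simp
  qed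
  have U: "E (mat_unit d a b) $$ (r, c) = (\<Sum>i\<in>{1..\<kappa>}. A i $$ (r, a) * cnj (A i $$ (c, b)))"
    if a: "a < d" and b: "b < d" for a b
  proof -
    have "(\<Sum>(a', b')\<in>{..<d} \<times> {..<d}.
            A i $$ (r, a') * mat_unit d a b $$ (a', b') * cnj (A i $$ (c, b')))
        = A i $$ (r, a) * cnj (A i $$ (c, b))" for i
    proof -
      have "(\<Sum>(a', b')\<in>{..<d} \<times> {..<d}.
              A i $$ (r, a') * mat_unit d a b $$ (a', b') * cnj (A i $$ (c, b')))
          = (\<Sum>p\<in>{..<d} \<times> {..<d}. if p = (a, b) then A i $$ (r, a) * cnj (A i $$ (c, b)) else 0)"
        by (rule sum.cong) (auto simp: mat_unit_def split: if_splits)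
      also have "\<dots> = A i $$ (r, a) * cnj (A i $$ (c, b))"
        using a b by (subst sum.delta) auto
      finally show ?thesis .
    qed
    moreover have "mat_unit d a b \<in> carrier_mat d d" by (simp add: mat_unit_def)
    ultimately show ?thesis by (simp add: E)
  qed
  have "E X $$ (r, c) = (\<Sum>p\<in>{..<d} \<times> {..<d}. \<Sum>i\<in>{1..\<kappa>}.
      case p of (a, b) \<Rightarrow> A i $$ (r, a) * X $$ (a, b) * cnj (A i $$ (c, b)))"
    unfolding E[OF X] by (rule sum.swap)
  also have "\<dots> = (\<Sum>(a, b)\<in>{..<d} \<times> {..<d}. X $$ (a, b) * E (mat_unit d a b) $$ (r, c))"
    by (rule sum.cong) (auto simp: U sum_distrib_left mult_ac)
  finally show ?thesis .
qed

lemma div_mod_less_mult: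
  fixes r d D :: nat
  assumes "r < d * D"
  shows "r div D < d" "r mod D < D"
proof -
  have "0 < D" using assms by (cases D) auto
  then show "r mod D < D" by simp
  show "r div D < d" using assms by (simp add: less_mult_imp_div_less)
qed

lemma channel_power_Suc_index:
  assumes q: "quantum_channel d E \<kappa> A" and r: "r < d * d ^ n" and c: "c < d * d ^ n"
  shows "channel_power d E (Suc n) X $$ (r, c) =
    (\<Sum>(a, b)\<in>{..<d} \<times> {..<d}. E (mat_unit d a b) $$ (r div d ^ n, c div d ^ n) *
       channel_power d E n (mat_block (d ^ n) a b X) $$ (r mod d ^ n, c mod d ^ n))"
proof -
  have 1: "E (mat_unit d a b) \<in> carrier_mat d d" for a b
    by (rule quantum_channel_carrier[OF q]) (simp add: mat_unit_def)
  have 2: "channel_power d E n (mat_block (d ^ n) a b X) \<in> carrier_mat (d ^ n) (d ^ n)" for a b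
    by (rule channel_power_carrier) (simp add: mat_block_def)
  have dims: "dim_row (E (mat_unit d a b)) = d" "dim_col (E (mat_unit d a b)) = d"
    "dim_row (channel_power d E n (mat_block (d ^ n) a b X)) = d ^ n"
    "dim_col (channel_power d E n (mat_block (d ^ n) a b X)) = d ^ n" for a b
    using 1[of a b] 2[of a b] by auto
  show ?thesis
    using r c unfolding channel_power.simps sum_of_mats_def
    by (auto simp: kron_def dims intro!: sum.cong)
qed

lemma channel_power_smult:
  assumes q: "quantum_channel d E \<kappa> A" and X: "X \<in> carrier_mat (d ^ n) (d ^ n)"
  shows "channel_power d E n (z \<cdot>\<^sub>m X) = z \<cdot>\<^sub>m channel_power d E n X"
  using X
proof (induction n arbitrary: X)
  case 0
  then show ?case by simp
next
  case (Suc n)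
  have blk: "mat_block (d ^ n) a b (z \<cdot>\<^sub>m X) = z \<cdot>\<^sub>m mat_block (d ^ n) a b X" if "a < d" "b < d" for a b
  proof -
    have *: "x * d ^ n + i < d * d ^ n" if "x < d" "i < d ^ n" for x i
    proof -
      have "x * d ^ n + i < Suc x * d ^ n" using that by simp
      also have "\<dots> \<le> d * d ^ n" using that by (intro mult_le_mono1) simp
      finally show ?thesis .
    qed
    show ?thesis
      using Suc.prems that by (intro eq_matI) (auto simp: mat_block_def *)
  qed
  have IH: "channel_power d E n (z \<cdot>\<^sub>m mat_block (d ^ n) a b X) =
      z \<cdot>\<^sub>m channel_power d E n (mat_block (d ^ n) a b X)" for a b
    by (rule Suc.IH) (simp add: mat_block_def)
  have car: "channel_power d E n (mat_block (d ^ n) a b X) \<in> carrier_mat (d ^ n) (d ^ n)" for a b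
    by (rule channel_power_carrier) (simp add: mat_block_def)
  have dims: "dim_row (channel_power d E (Suc n) Y) = d * d ^ n"
      "dim_col (channel_power d E (Suc n) Y) = d * d ^ n" for Y
    by (simp_all add: sum_of_mats_def)
  show ?case
  proof (rule eq_matI)
    fix r c assume "r < dim_row (z \<cdot>\<^sub>m channel_power d E (Suc n) X)"
      "c < dim_col (z \<cdot>\<^sub>m channel_power d E (Suc n) X)"
    then have r: "r < d * d ^ n" and c: "c < d * d ^ n"
      unfolding index_smult_mat(2,3) dims by auto
    note m = div_mod_less_mult[OF r] div_mod_less_mult[OF c]
    have "channel_power d E (Suc n) (z \<cdot>\<^sub>m X) $$ (r, c) =
      z * channel_power d E (Suc n) X $$ (r, c)"
      unfolding channel_power_Suc_index[OF q r c] sum_distrib_left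
      using m carrier_matD[OF car]
      by (intro sum.cong) (auto simp: blk IH mult_ac)
    then show "channel_power d E (Suc n) (z \<cdot>\<^sub>m X) $$ (r, c) =
        (z \<cdot>\<^sub>m channel_power d E (Suc n) X) $$ (r, c)"
      using r c dims by (subst index_smult_mat(1)) auto
  qed (simp_all only: index_smult_mat dims)
qed

lemma channel_power_kron:
  assumes q: "quantum_channel d E \<kappa> A" and X: "X \<in> carrier_mat d d"
    and Y: "Y \<in> carrier_mat (d ^ n) (d ^ n)"
  shows "channel_power d E (Suc n) (kron X Y) = kron (E X) (channel_power d E n Y)"
proof -
  have blk: "mat_block (d ^ n) a b (kron X Y) = X $$ (a, b) \<cdot>\<^sub>m Y" if "a < d" "b < d" for a b
  proof -
    have *: "x * d ^ n + i < d * d ^ n" if "x < d" "i < d ^ n" for x i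
    proof -
      have "x * d ^ n + i < Suc x * d ^ n" using that by simp
      also have "\<dots> \<le> d * d ^ n" using that by (intro mult_le_mono1) simp
      finally show ?thesis .
    qed
    show ?thesis
      using X Y that by (intro eq_matI) (auto simp: mat_block_def kron_def *)
  qed
  note EX = carrier_matD[OF quantum_channel_carrier[OF q X]]
  note PY = carrier_matD[OF channel_power_carrier[OF Y, of E]]
  have dims: "dim_row (channel_power d E (Suc n) Z) = d * d ^ n"
      "dim_col (channel_power d E (Suc n) Z) = d * d ^ n" for Z
    by (simp_all add: sum_of_mats_def)
  have kdims: "dim_row (kron (E X) (channel_power d E n Y)) = d * d ^ n"
      "dim_col (kron (E X) (channel_power d E n Y)) = d * d ^ n"
    by (simp_all add: kron_def EX PY)
  show ?thesis
  proof (rule eq_matI)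
    fix r c assume "r < dim_row (kron (E X) (channel_power d E n Y))"
      "c < dim_col (kron (E X) (channel_power d E n Y))"
    then have r: "r < d * d ^ n" and c: "c < d * d ^ n" by (simp_all only: kdims)
    note m = div_mod_less_mult[OF r] div_mod_less_mult[OF c]
    have "channel_power d E (Suc n) (kron X Y) $$ (r, c) =
      (\<Sum>(a, b)\<in>{..<d} \<times> {..<d}. X $$ (a, b) * E (mat_unit d a b) $$ (r div d ^ n, c div d ^ n))
        * channel_power d E n Y $$ (r mod d ^ n, c mod d ^ n)"
      unfolding channel_power_Suc_index[OF q r c] sum_distrib_right
      using m PY by (intro sum.cong) (auto simp: blk channel_power_smult[OF q Y])
    also have "\<dots> = kron (E X) (channel_power d E n Y) $$ (r, c)"
      using r c m by (simp add: kron_def EX PY quantum_channel_index[OF q X])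
    finally show "channel_power d E (Suc n) (kron X Y) $$ (r, c) =
      kron (E X) (channel_power d E n Y) $$ (r, c)" .
  qed (simp_all only: dims kdims)
qed

end

theory Submission
  imports Defs
begin

(* A channel preserves inner products summed over its Kraus operators. Hence, if the common
   eigenvectors psi and phi are not orthogonal, then the eigenvalue vectors satisfy
   <mu, nu> = 1 with |mu| = |nu| = 1, so they coincide by the equality case of Cauchy-Schwarz;
   the part of phi orthogonal to psi is then a common eigenvector as well. So there are always
   two orthogonal common eigenstates. The channel fixes both of them, and the measurement
   along one of them distinguishes them without error: one use transmits two messages. *)

section \<open>Inner products, adjoints and finite operator sums\<close>

lemma cscalar_prod_eq_sum:
  fixes v w :: "complex vec"
  assumes "w \<in> carrier_vec n"
  shows "v \<bullet>c w = (\<Sum>i<n. v $ i * cnj (w $ i))"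
  using assms by (auto simp: scalar_prod_def atLeast0LessThan intro!: sum.cong)

lemma cscalar_prod_commute:
  fixes v w :: "complex vec"
  assumes "v \<in> carrier_vec n" "w \<in> carrier_vec n"
  shows "v \<bullet>c w = cnj (w \<bullet>c v)"
  using assms by (simp add: cscalar_prod_eq_sum[of _ n] mult.commute)

lemma cscalar_prod_smult_left:
  fixes v w :: "complex vec"
  assumes "v \<in> carrier_vec n" "w \<in> carrier_vec n"
  shows "(z \<cdot>\<^sub>v v) \<bullet>c w = z * (v \<bullet>c w)"
  using assms by simp

lemma cscalar_prod_smult_right:
  fixes v w :: "complex vec"
  assumes "v \<in> carrier_vec n" "w \<in> carrier_vec n"
  shows "v \<bullet>c (z \<cdot>\<^sub>v w) = cnj z * (v \<bullet>c w)"
  using assms by (simp add: conjugate_smult_vec)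

lemma cscalar_prod_minus_left:
  fixes u v w :: "complex vec"
  assumes "u \<in> carrier_vec n" "v \<in> carrier_vec n" "w \<in> carrier_vec n"
  shows "(u - v) \<bullet>c w = u \<bullet>c w - v \<bullet>c w"
  using assms by (simp add: minus_scalar_prod_distrib)

lemma cscalar_prod_minus_right:
  fixes u v w :: "complex vec"
  assumes "u \<in> carrier_vec n" "v \<in> carrier_vec n" "w \<in> carrier_vec n"
  shows "u \<bullet>c (v - w) = u \<bullet>c v - u \<bullet>c w"
  using assms
  by (simp add: cscalar_prod_eq_sum[of _ n] right_diff_distrib sum_subtractf)

lemma complex_mult_cnj_nonneg: "0 \<le> z * cnj z"
  by (simp add: less_eq_complex_def complex_mult_cnj)

lemma mult_mat_vec_index_sum:
  assumes "X \<in> carrier_mat n n" "v \<in> carrier_vec n" "i < n"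
  shows "(X *\<^sub>v v) $ i = (\<Sum>j<n. X $$ (i, j) * v $ j)"
  using assms by (auto simp: scalar_prod_def atLeast0LessThan intro!: sum.cong)

text \<open>Moves an entrywise operator sum into the scalars, where the ordinary \<open>sum\<close>
  is available. Both completeness relations, that of the Kraus operators and that of a POVM, are
  exploited in this form.\<close>

lemma sum_of_mats_mult_vec_cscalar_prod:
  assumes F: "\<And>i. i \<in> I \<Longrightarrow> F i \<in> carrier_mat n n"
    and v: "v \<in> carrier_vec n" and w: "w \<in> carrier_vec n"
  shows "(sum_of_mats n F I *\<^sub>v v) \<bullet>c w = (\<Sum>i\<in>I. (F i *\<^sub>v v) \<bullet>c w)"
proof -
  have "(sum_of_mats n F I *\<^sub>v v) \<bullet>c w
      = (\<Sum>r<n. (\<Sum>c<n. (\<Sum>i\<in>I. F i $$ (r, c)) * v $ c) * cnj (w $ r))"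
    unfolding cscalar_prod_eq_sum[OF w]
    by (intro sum.cong refl arg_cong2[of _ _ _ _ "(*)"])
       (subst mult_mat_vec_index_sum[of _ n], auto simp: sum_of_mats_def v)
  also have "\<dots> = (\<Sum>r<n. \<Sum>i\<in>I. (\<Sum>c<n. F i $$ (r, c) * v $ c) * cnj (w $ r))"
    by (simp only: sum_distrib_right sum.swap[of _ I])
  also have "\<dots> = (\<Sum>i\<in>I. \<Sum>r<n. (\<Sum>c<n. F i $$ (r, c) * v $ c) * cnj (w $ r))"
    by (rule sum.swap)
  also have "\<dots> = (\<Sum>i\<in>I. (F i *\<^sub>v v) \<bullet>c w)"
    unfolding cscalar_prod_eq_sum[OF w]
    by (intro sum.cong refl arg_cong2[of _ _ _ _ "(*)"])
       (subst mult_mat_vec_index_sum[of _ n], auto simp: F v)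
  finally show ?thesis .
qed

lemma mat_adjoint_carrier:
  "X \<in> carrier_mat n m \<Longrightarrow> mat_adjoint X \<in> carrier_mat m n"
  by (auto simp: mat_adjoint_def)

lemma mat_adjoint_mult_vec_cscalar_prod:
  fixes X :: "complex mat"
  assumes X: "X \<in> carrier_mat n n" and v: "v \<in> carrier_vec n" and w: "w \<in> carrier_vec n"
  shows "(mat_adjoint X *\<^sub>v v) \<bullet>c w = v \<bullet>c (X *\<^sub>v w)"
proof -
  have Xw: "X *\<^sub>v w \<in> carrier_vec n" using X w by simp
  have "(mat_adjoint X *\<^sub>v v) \<bullet>c w = (\<Sum>r<n. (\<Sum>c<n. cnj (X $$ (c, r)) * v $ c) * cnj (w $ r))"
    unfolding cscalar_prod_eq_sum[OF w]
    by (intro sum.cong refl arg_cong2[of _ _ _ _ "(*)"])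
       (subst mult_mat_vec_index_sum[of _ n],
        auto simp: mat_adjoint_carrier X v mat_adjoint_index[OF X])
  also have "\<dots> = (\<Sum>r<n. \<Sum>c<n. v $ c * (cnj (X $$ (c, r)) * cnj (w $ r)))"
    by (simp add: sum_distrib_left sum_distrib_right mult_ac)
  also have "\<dots> = (\<Sum>c<n. v $ c * (\<Sum>r<n. cnj (X $$ (c, r)) * cnj (w $ r)))"
    by (subst sum.swap) (simp add: sum_distrib_left)
  also have "\<dots> = v \<bullet>c (X *\<^sub>v w)"
    unfolding cscalar_prod_eq_sum[OF Xw]
    by (intro sum.cong refl arg_cong2[of _ _ _ _ "(*)"])
       (simp add: mult_mat_vec_index_sum[OF X w])
  finally show ?thesis .
qed

section \<open>Rank-one operators and the two projections of a yes-no measurement\<close>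

definition pure_state :: "complex vec \<Rightarrow> complex mat" where
  "pure_state v = mat (dim_vec v) (dim_vec v) (\<lambda>(i, j). v $ i * cnj (v $ j))"

lemma pure_state_carrier [simp]: "v \<in> carrier_vec n \<Longrightarrow> pure_state v \<in> carrier_mat n n"
  by (simp add: pure_state_def)

lemma pure_state_index:
  "v \<in> carrier_vec n \<Longrightarrow> i < n \<Longrightarrow> j < n \<Longrightarrow> pure_state v $$ (i, j) = v $ i * cnj (v $ j)"
  by (simp add: pure_state_def)

lemma pure_state_mult_vec:
  assumes v: "v \<in> carrier_vec n" and w: "w \<in> carrier_vec n"
  shows "pure_state v *\<^sub>v w = (w \<bullet>c v) \<cdot>\<^sub>v v"
proof (rule eq_vecI)
  fix i assume "i < dim_vec ((w \<bullet>c v) \<cdot>\<^sub>v v)"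
  then have i: "i < n" using v by simp
  show "(pure_state v *\<^sub>v w) $ i = ((w \<bullet>c v) \<cdot>\<^sub>v v) $ i"
    unfolding mult_mat_vec_index_sum[OF pure_state_carrier[OF v] w i] cscalar_prod_eq_sum[OF v]
    using v i by (simp add: pure_state_index[OF v] sum_distrib_left sum_distrib_right mult_ac)
qed (use v in \<open>simp add: pure_state_def\<close>)

text \<open>Turns an outcome probability on a pure output into a quadratic form, the form in which
  \<open>pos_semidef\<close> speaks about \<open>M\<close>.\<close>

lemma mat_trace_pure_state_mult:
  assumes v: "v \<in> carrier_vec n" and M: "M \<in> carrier_mat n n"
  shows "mat_trace (pure_state v * M) = (M *\<^sub>v v) \<bullet>c v"
proof -
  have "mat_trace (pure_state v * M) = (\<Sum>i<n. \<Sum>k<n. v $ i * cnj (v $ k) * M $$ (k, i))"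
    using pure_state_carrier[OF v] M
    by (auto simp: mat_trace_def scalar_prod_def pure_state_index[OF v] atLeast0LessThan
        intro!: sum.cong)
  also have "\<dots> = (\<Sum>k<n. (\<Sum>i<n. M $$ (k, i) * v $ i) * cnj (v $ k))"
    by (subst sum.swap) (simp add: sum_distrib_left sum_distrib_right mult_ac)
  also have "\<dots> = (M *\<^sub>v v) \<bullet>c v"
    unfolding cscalar_prod_eq_sum[OF v]
    by (intro sum.cong refl arg_cong2[of _ _ _ _ "(*)"])
       (simp add: mult_mat_vec_index_sum[OF M v])
  finally show ?thesis .
qed

lemma mat_trace_pure_state:
  assumes v: "v \<in> carrier_vec n"
  shows "mat_trace (pure_state v) = v \<bullet>c v"
  using v by (simp add: mat_trace_def cscalar_prod_eq_sum[OF v] pure_state_def)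

lemma pure_state_smult:
  "pure_state (z \<cdot>\<^sub>v v) = (z * cnj z) \<cdot>\<^sub>m pure_state v"
  by (rule eq_matI) (auto simp: pure_state_def)

text \<open>Reduces the action of a Kraus operator on a pure state to its action on the vector,
  where an eigenvalue equation can be applied.\<close>

lemma conjugation_pure_state:
  assumes A: "A \<in> carrier_mat n n" and v: "v \<in> carrier_vec n"
  shows "A * pure_state v * mat_adjoint A = pure_state (A *\<^sub>v v)"
proof (rule eq_matI)
  note P = pure_state_carrier[OF v] and Q = mat_adjoint_carrier[OF A]
  have Av: "A *\<^sub>v v \<in> carrier_vec n" using A v by simp
  fix r c assume "r < dim_row (pure_state (A *\<^sub>v v))" "c < dim_col (pure_state (A *\<^sub>v v))"
  then have rc: "r < n" "c < n" using pure_state_carrier[OF Av] by auto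
  have "(A * pure_state v * mat_adjoint A) $$ (r, c)
      = (\<Sum>b<n. (\<Sum>a<n. A $$ (r, a) * (v $ a * cnj (v $ b))) * cnj (A $$ (c, b)))"
    using A P Q rc
    by (auto simp: scalar_prod_def pure_state_index[OF v] mat_adjoint_index[OF A]
        atLeast0LessThan simp del: assoc_mult_mat intro!: sum.cong)
  also have "\<dots> = (\<Sum>a<n. A $$ (r, a) * v $ a) * cnj (\<Sum>b<n. A $$ (c, b) * v $ b)"
    by (simp add: sum_product sum_distrib_left sum_distrib_right mult_ac)
  also have "\<dots> = pure_state (A *\<^sub>v v) $$ (r, c)"
    by (simp only: pure_state_index[OF Av rc] mult_mat_vec_index_sum[OF A v] rc)
  finally show "(A * pure_state v * mat_adjoint A) $$ (r, c) = pure_state (A *\<^sub>v v) $$ (r, c)" .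
qed (use A v mat_adjoint_carrier[OF A] in \<open>auto simp: pure_state_def\<close>)

lemma pos_semidef_pure_state:
  assumes v: "v \<in> carrier_vec n"
  shows "pos_semidef n (pure_state v)"
  unfolding pos_semidef_def
proof (intro conjI ballI)
  fix w :: "complex vec" assume w: "w \<in> carrier_vec n"
  have "(pure_state v *\<^sub>v w) \<bullet>c w = (w \<bullet>c v) * cnj (w \<bullet>c v)"
    unfolding pure_state_mult_vec[OF v w] cscalar_prod_smult_left[OF v w]
    by (simp only: cscalar_prod_commute[OF v w])
  then show "0 \<le> (pure_state v *\<^sub>v w) \<bullet>c w" by (simp only: complex_mult_cnj_nonneg)
qed (use v in simp)

text \<open>For a unit vector this operator is the orthogonal projection onto the complement of
  \<open>v\<close>. With \<open>u\<close> the projection of \<open>w\<close>, its quadratic form at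
  \<open>w\<close> is the squared norm of \<open>u\<close>.\<close>

lemma pos_semidef_one_minus_pure_state:
  assumes v: "v \<in> carrier_vec n" and unit: "v \<bullet>c v = 1"
  shows "pos_semidef n (1\<^sub>m n - pure_state v)"
  unfolding pos_semidef_def
proof (intro conjI ballI)
  fix w :: "complex vec" assume w: "w \<in> carrier_vec n"
  define u where "u = w - (w \<bullet>c v) \<cdot>\<^sub>v v"
  have u: "u \<in> carrier_vec n" unfolding u_def using v w by simp
  have uv: "u \<bullet>c v = 0"
    unfolding u_def using v w unit
    by (simp add: cscalar_prod_minus_left[of _ n])
  have "(1\<^sub>m n - pure_state v) *\<^sub>v w = u"
    unfolding u_def pure_state_mult_vec[OF v w, symmetric]
    using v w by (simp add: minus_mult_distrib_mat_vec[of _ n n])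
  \<comment> \<open>Only the second factor is expanded: its component along \<open>v\<close>
    contributes nothing, since \<open>u\<close> is orthogonal to \<open>v\<close>.\<close>
  moreover have "u \<bullet>c u = u \<bullet>c w"
    by (subst (2) u_def)
       (simp add: cscalar_prod_minus_right[of _ n] cscalar_prod_smult_right[of _ n] u v w uv)
  ultimately show "0 \<le> ((1\<^sub>m n - pure_state v) *\<^sub>v w) \<bullet>c w"
    using conjugate_square_ge_0_vec[of u] by simp
qed (intro minus_carrier_mat pure_state_carrier v)

section \<open>Common eigenvectors of the Kraus operators\<close>

lemma quantum_channel_cscalar_prod:
  assumes q: "quantum_channel d E \<kappa> A"
    and v: "v \<in> carrier_vec d" and w: "w \<in> carrier_vec d"
  shows "(\<Sum>i\<in>{1..\<kappa>}. (A i *\<^sub>v v) \<bullet>c (A i *\<^sub>v w)) = v \<bullet>c w"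
proof -
  have A: "A i \<in> carrier_mat d d" if "i \<in> {1..\<kappa>}" for i
    using q that by (auto simp: quantum_channel_def)
  have "v \<bullet>c w = (sum_of_mats d (\<lambda>i. mat_adjoint (A i) * A i) {1..\<kappa>} *\<^sub>v v) \<bullet>c w"
    using q v by (simp add: quantum_channel_def)
  also have "\<dots> = (\<Sum>i\<in>{1..\<kappa>}. (mat_adjoint (A i) * A i *\<^sub>v v) \<bullet>c w)"
    by (rule sum_of_mats_mult_vec_cscalar_prod)
       (use A mat_adjoint_carrier[OF A] v w in \<open>auto intro!: mult_carrier_mat\<close>)
  also have "\<dots> = (\<Sum>i\<in>{1..\<kappa>}. (A i *\<^sub>v v) \<bullet>c (A i *\<^sub>v w))"
  proof (rule sum.cong[OF refl])
    fix i assume "i \<in> {1..\<kappa>}"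
    note A = A[OF this]
    have "mat_adjoint (A i) * A i *\<^sub>v v = mat_adjoint (A i) *\<^sub>v (A i *\<^sub>v v)"
      by (rule assoc_mult_mat_vec[OF mat_adjoint_carrier[OF A] A v])
    then show "(mat_adjoint (A i) * A i *\<^sub>v v) \<bullet>c w = (A i *\<^sub>v v) \<bullet>c (A i *\<^sub>v w)"
      using mat_adjoint_mult_vec_cscalar_prod[OF A _ w, of "A i *\<^sub>v v"] A v by simp
  qed
  finally show ?thesis by simp
qed

text \<open>In the preserved inner product, the eigenvalue equations turn each summand into a
  multiple of \<open>v \<bullet>c w\<close>, and this nonzero factor cancels. Taken with
  \<open>w = v\<close>, the result says that the vector of eigenvalues has norm 1.\<close>

lemma quantum_channel_eigenvalue_sum:
  assumes q: "quantum_channel d E \<kappa> A"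
    and v: "v \<in> carrier_vec d" and w: "w \<in> carrier_vec d"
    and ev: "\<And>i. i \<in> {1..\<kappa>} \<Longrightarrow> A i *\<^sub>v v = \<nu> i \<cdot>\<^sub>v v"
    and ew: "\<And>i. i \<in> {1..\<kappa>} \<Longrightarrow> A i *\<^sub>v w = \<mu> i \<cdot>\<^sub>v w"
    and nz: "v \<bullet>c w \<noteq> 0"
  shows "(\<Sum>i\<in>{1..\<kappa>}. \<nu> i * cnj (\<mu> i)) = 1"
proof -
  have "v \<bullet>c w = (\<Sum>i\<in>{1..\<kappa>}. (A i *\<^sub>v v) \<bullet>c (A i *\<^sub>v w))"
    by (rule quantum_channel_cscalar_prod[OF q v w, symmetric])
  also have "\<dots> = (\<Sum>i\<in>{1..\<kappa>}. \<nu> i * cnj (\<mu> i) * (v \<bullet>c w))"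
    by (intro sum.cong refl)
       (simp add: ev ew cscalar_prod_smult_left[of _ d] cscalar_prod_smult_right[of _ d] v w
         del: smult_scalar_prod_distrib)
  also have "\<dots> = (\<Sum>i\<in>{1..\<kappa>}. \<nu> i * cnj (\<mu> i)) * (v \<bullet>c w)"
    by (simp only: sum_distrib_right)
  finally show ?thesis using nz by simp
qed

text \<open>Each Kraus term is the state itself scaled by the squared modulus of the eigenvalue, and
  these weights sum to 1.\<close>

lemma quantum_channel_fixes_common_eigenstate:
  assumes q: "quantum_channel d E \<kappa> A"
    and v: "v \<in> carrier_vec d" and unit: "v \<bullet>c v = 1"
    and ev: "\<And>i. i \<in> {1..\<kappa>} \<Longrightarrow> A i *\<^sub>v v = \<nu> i \<cdot>\<^sub>v v"
  shows "E (pure_state v) = pure_state v"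
proof -
  note P = pure_state_carrier[OF v]
  have A: "A i \<in> carrier_mat d d" if "i \<in> {1..\<kappa>}" for i
    using q that by (auto simp: quantum_channel_def)
  have one: "(\<Sum>i\<in>{1..\<kappa>}. \<nu> i * cnj (\<nu> i)) = 1"
    using quantum_channel_eigenvalue_sum[OF q v v ev ev] unit by simp
  have "A i * pure_state v * mat_adjoint (A i) = (\<nu> i * cnj (\<nu> i)) \<cdot>\<^sub>m pure_state v"
    if "i \<in> {1..\<kappa>}" for i
    by (simp only: conjugation_pure_state[OF A[OF that] v] ev[OF that] pure_state_smult)
  then have "E (pure_state v)
      = sum_of_mats d (\<lambda>i. (\<nu> i * cnj (\<nu> i)) \<cdot>\<^sub>m pure_state v) {1..\<kappa>}"
    using q P by (auto simp: quantum_channel_def sum_of_mats_def intro!: eq_matI sum.cong)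
  also have "\<dots> = pure_state v"
  proof (rule eq_matI)
    fix r c assume "r < dim_row (pure_state v)" "c < dim_col (pure_state v)"
    then show "sum_of_mats d (\<lambda>i. (\<nu> i * cnj (\<nu> i)) \<cdot>\<^sub>m pure_state v) {1..\<kappa>} $$ (r, c)
        = pure_state v $$ (r, c)"
      using P one by (simp add: sum_of_mats_def sum_distrib_right[symmetric])
  qed (use P in \<open>auto simp: sum_of_mats_def\<close>)
  finally show ?thesis .
qed

text \<open>Equality case of Cauchy-Schwarz by direct expansion: the squared distance of the two
  eigenvalue vectors is 1 - 1 - 1 + 1 = 0, so every coordinate of the difference vanishes.\<close>

lemma common_eigenvalues_eq:
  assumes q: "quantum_channel d E \<kappa> A"
    and v: "v \<in> carrier_vec d" "v \<bullet>c v = 1" and w: "w \<in> carrier_vec d" "w \<bullet>c w = 1"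
    and ev: "\<And>i. i \<in> {1..\<kappa>} \<Longrightarrow> A i *\<^sub>v v = \<nu> i \<cdot>\<^sub>v v"
    and ew: "\<And>i. i \<in> {1..\<kappa>} \<Longrightarrow> A i *\<^sub>v w = \<mu> i \<cdot>\<^sub>v w"
    and nz: "v \<bullet>c w \<noteq> 0" and i: "i \<in> {1..\<kappa>}"
  shows "\<nu> i = \<mu> i"
proof -
  have nz': "w \<bullet>c v \<noteq> 0" using nz cscalar_prod_commute[OF v(1) w(1)] by auto
  have sums: "(\<Sum>i\<in>{1..\<kappa>}. \<nu> i * cnj (\<nu> i)) = 1" "(\<Sum>i\<in>{1..\<kappa>}. \<mu> i * cnj (\<mu> i)) = 1"
    "(\<Sum>i\<in>{1..\<kappa>}. \<nu> i * cnj (\<mu> i)) = 1" "(\<Sum>i\<in>{1..\<kappa>}. \<mu> i * cnj (\<nu> i)) = 1"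
    using quantum_channel_eigenvalue_sum[OF q v(1) v(1) ev ev] v(2)
      quantum_channel_eigenvalue_sum[OF q w(1) w(1) ew ew] w(2)
      quantum_channel_eigenvalue_sum[OF q v(1) w(1) ev ew nz]
      quantum_channel_eigenvalue_sum[OF q w(1) v(1) ew ev nz'] by simp_all
  have "(\<Sum>i\<in>{1..\<kappa>}. (\<nu> i - \<mu> i) * cnj (\<nu> i - \<mu> i))
      = (\<Sum>i\<in>{1..\<kappa>}. \<nu> i * cnj (\<nu> i)) - (\<Sum>i\<in>{1..\<kappa>}. \<nu> i * cnj (\<mu> i))
        - (\<Sum>i\<in>{1..\<kappa>}. \<mu> i * cnj (\<nu> i)) + (\<Sum>i\<in>{1..\<kappa>}. \<mu> i * cnj (\<mu> i))"
    by (simp add: algebra_simps sum.distrib sum_subtractf)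
  also have "\<dots> = 0" unfolding sums by simp
  finally have "(\<Sum>i\<in>{1..\<kappa>}. (\<nu> i - \<mu> i) * cnj (\<nu> i - \<mu> i)) = 0" .
  then have "(\<nu> i - \<mu> i) * cnj (\<nu> i - \<mu> i) = 0"
    using i by (subst (asm) sum_nonneg_eq_0_iff) (auto simp only: complex_mult_cnj_nonneg finite_atLeastAtMost)
  then show ?thesis by simp
qed

lemma exists_unit_multiple:
  fixes v :: "complex vec"
  assumes v: "v \<in> carrier_vec n" and nz: "v \<noteq> 0\<^sub>v n"
  shows "\<exists>z. (z \<cdot>\<^sub>v v) \<bullet>c (z \<cdot>\<^sub>v v) = 1"
proof -
  define s where "s = Re (v \<bullet>c v)"
  \<comment> \<open>In the order on complex numbers this makes \<open>v \<bullet>c v\<close> real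
    and positive, so \<open>1 / sqrt s\<close> can serve as the scalar.\<close>
  have "0 < v \<bullet>c v" using v nz by simp
  then have s: "v \<bullet>c v = complex_of_real s" "s > 0"
    by (auto simp: s_def less_complex_def complex_eq_iff)
  have "(complex_of_real (1 / sqrt s) \<cdot>\<^sub>v v) \<bullet>c (complex_of_real (1 / sqrt s) \<cdot>\<^sub>v v)
      = complex_of_real (1 / sqrt s * (1 / sqrt s) * s)"
    using v by (simp only: cscalar_prod_smult_left[of _ n] cscalar_prod_smult_right[of _ n]
        smult_carrier_vec s(1) complex_cnj_complex_of_real of_real_mult mult.assoc)
  also have "\<dots> = 1" using s(2) by simp
  finally show ?thesis by blast
qed

text \<open>If the two vectors are orthogonal, \<open>w\<close> itself serves. Otherwise one
  Gram-Schmidt step gives the vector: it is nonzero because \<open>w\<close> is not a multiple of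
  \<open>v\<close>, and it is normalised at the end.\<close>

lemma exists_orthogonal_common_eigenvector:
  assumes q: "quantum_channel d E \<kappa> A"
    and v: "v \<in> carrier_vec d" "v \<bullet>c v = 1" and w: "w \<in> carrier_vec d" "w \<bullet>c w = 1"
    and not_multiple: "\<not> (\<exists>z. w = z \<cdot>\<^sub>v v)"
    and ev: "\<And>i. i \<in> {1..\<kappa>} \<Longrightarrow> A i *\<^sub>v v = \<nu> i \<cdot>\<^sub>v v"
    and ew: "\<And>i. i \<in> {1..\<kappa>} \<Longrightarrow> A i *\<^sub>v w = \<mu> i \<cdot>\<^sub>v w"
  shows "\<exists>u. u \<in> carrier_vec d \<and> u \<bullet>c u = 1 \<and> u \<bullet>c v = 0
    \<and> (\<forall>i\<in>{1..\<kappa>}. A i *\<^sub>v u = \<mu> i \<cdot>\<^sub>v u)"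
proof (cases "v \<bullet>c w = 0")
  case True
  then have "w \<bullet>c v = 0" using cscalar_prod_commute[OF w(1) v(1)] by simp
  with w ew show ?thesis by blast
next
  case False
  have A: "A i \<in> carrier_mat d d" if "i \<in> {1..\<kappa>}" for i
    using q that by (auto simp: quantum_channel_def)
  define y where "y = w - (w \<bullet>c v) \<cdot>\<^sub>v v"
  have y: "y \<in> carrier_vec d" unfolding y_def using v w by simp
  have yv: "y \<bullet>c v = 0"
    unfolding y_def using v w by (simp add: cscalar_prod_minus_left[of _ d])
  have "y \<noteq> 0\<^sub>v d"
  proof
    assume "y = 0\<^sub>v d"
    then have "w = (w \<bullet>c v) \<cdot>\<^sub>v v"
      using v w unfolding y_def vec_eq_iff by auto
    with not_multiple show False by blast
  qed
  then obtain z where z: "(z \<cdot>\<^sub>v y) \<bullet>c (z \<cdot>\<^sub>v y) = 1" using exists_unit_multiple[OF y] by blast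
  have ey: "A i *\<^sub>v y = \<mu> i \<cdot>\<^sub>v y" if i: "i \<in> {1..\<kappa>}" for i
  proof -
    \<comment> \<open>A difference of eigenvectors is an eigenvector here only because both belong
      to the same eigenvalue of \<open>A i\<close>; this is where non-orthogonality enters.\<close>
    have eq: "\<nu> i = \<mu> i" by (rule common_eigenvalues_eq[OF q v w ev ew False i])
    have "A i *\<^sub>v y = A i *\<^sub>v w - A i *\<^sub>v ((w \<bullet>c v) \<cdot>\<^sub>v v)"
      unfolding y_def using A[OF i] v w by (simp add: mult_minus_distrib_mat_vec[of _ d d])
    also have "\<dots> = \<mu> i \<cdot>\<^sub>v w - (w \<bullet>c v) \<cdot>\<^sub>v (\<nu> i \<cdot>\<^sub>v v)"
      using A[OF i] v i by (simp only: mult_mat_vec[of _ d d] ev ew)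
    also have "\<dots> = \<mu> i \<cdot>\<^sub>v y"
      using v w eq unfolding y_def by (intro eq_vecI) (auto simp: algebra_simps)
    finally show ?thesis .
  qed
  have "A i *\<^sub>v (z \<cdot>\<^sub>v y) = \<mu> i \<cdot>\<^sub>v (z \<cdot>\<^sub>v y)" if "i \<in> {1..\<kappa>}" for i
    using mult_mat_vec[OF A[OF that] y, of z] ey[OF that] by (simp add: smult_smult_assoc mult.commute)
  moreover have "(z \<cdot>\<^sub>v y) \<bullet>c v = 0" using y v yv by simp
  ultimately show ?thesis using y z by (intro exI[of _ "z \<cdot>\<^sub>v y"]) auto
qed

section \<open>Input states and a single use of the channel\<close>

lemma pure_state_in_density_ops:
  assumes "v \<in> carrier_vec n" "v \<bullet>c v = 1"
  shows "pure_state v \<in> density_ops n"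
  using assms by (simp add: density_ops_def pos_semidef_pure_state mat_trace_pure_state)

text \<open>\<open>kron_list\<close> ends in the 1 x 1 identity, so a word with one letter carries
  this extra factor.\<close>

lemma kron_one_right: "kron X (1\<^sub>m 1) = X"
  by (rule eq_matI) (auto simp: kron_def)

lemma tensor_states_one: "tensor_states S 1 = S"
proof -
  have "kron_list \<rho>s \<in> S" if "length \<rho>s = 1" "set \<rho>s \<subseteq> S" for \<rho>s
    using that by (cases \<rho>s) (auto simp: kron_one_right simp del: One_nat_def)
  moreover have "\<rho> \<in> tensor_states S 1" if "\<rho> \<in> S" for \<rho>
    unfolding tensor_states_def
    by (rule CollectI, rule exI[of _ "[\<rho>]"]) (use that kron_one_right[of \<rho>] in simp)
  ultimately show ?thesis unfolding tensor_states_def by blast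
qed

text \<open>The recursion evaluates \<open>E\<close> at matrix units only, so agreement with
  \<open>E\<close> at \<open>X\<close> rests on linearity. This is already contained in
  \<open>channel_power_kron\<close>, used with \<open>n = 0\<close> and the 1 x 1 identity as second
  factor.\<close>

lemma channel_power_one:
  assumes q: "quantum_channel d E \<kappa> A" and X: "X \<in> carrier_mat d d"
  shows "channel_power d E 1 X = E X"
  using channel_power_kron[OF q X, of "1\<^sub>m 1" 0] by (simp add: kron_one_right[simplified])

section \<open>Zero-error codes: a bound on the number of messages and a code with two
  messages\<close>

lemma povm_quadratic_sum:
  assumes "povm n k M" "v \<in> carrier_vec n"
  shows "(\<Sum>j\<in>{1..k}. (M j *\<^sub>v v) \<bullet>c v) = v \<bullet>c v"
proof -
  have "(\<Sum>j\<in>{1..k}. (M j *\<^sub>v v) \<bullet>c v) = (sum_of_mats n M {1..k} *\<^sub>v v) \<bullet>c v"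
    by (rule sum_of_mats_mult_vec_cscalar_prod[symmetric])
       (use assms in \<open>auto simp: povm_def pos_semidef_def\<close>)
  then show ?thesis using assms by (simp add: povm_def)
qed

text \<open>If two messages shared an input state, they would share the outcome distribution. Every
  outcome is decoded wrongly for at least one of them and so would have probability 0, while the
  probabilities on a unit vector sum to 1.\<close>

lemma zero_error_code_inj:
  assumes code: "zero_error_code d E S m n f k M g"
    and pure: "\<And>\<sigma>. \<sigma> \<in> tensor_states S n \<Longrightarrow>
      \<exists>v \<in> carrier_vec (d ^ n). v \<bullet>c v = 1 \<and> channel_power d E n \<sigma> = pure_state v"
  shows "inj_on f {1..m}"
proof (rule inj_onI, rule ccontr)
  fix a b assume a: "a \<in> {1..m}" and b: "b \<in> {1..m}" and eq: "f a = f b" and ne: "a \<noteq> b"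
  have fa: "f a \<in> tensor_states S n" and povm: "povm (d ^ n) k M"
    using code a by (auto simp: zero_error_code_def)
  obtain v where v: "v \<in> carrier_vec (d ^ n)" "v \<bullet>c v = 1"
    "channel_power d E n (f a) = pure_state v" using pure[OF fa] by blast
  have M: "pos_semidef (d ^ n) (M j)" if "j \<in> {1..k}" for j
    using povm that by (simp add: povm_def)
  have prob: "outcome_prob d E n f M j i = (M j *\<^sub>v v) \<bullet>c v"
    if "j \<in> {1..k}" "f i = f a" for i j
    using M[OF that(1)] v that(2)
    by (simp add: outcome_prob_def mat_trace_pure_state_mult[of _ "d ^ n"] pos_semidef_def)
  \<comment> \<open>The code condition concerns only the sum over wrong outcomes; positivity of each
    \<open>M j\<close> makes every single term vanish.\<close>
  have zero: "(M j *\<^sub>v v) \<bullet>c v = 0"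
    if i: "i \<in> {1..m}" "f i = f a" and j: "j \<in> {1..k}" "g j \<noteq> i" for i j
  proof -
    have "(\<Sum>j\<in>{j \<in> {1..k}. g j \<noteq> i}. (M j *\<^sub>v v) \<bullet>c v)
        = (\<Sum>j\<in>{j \<in> {1..k}. g j \<noteq> i}. outcome_prob d E n f M j i)"
      by (rule sum.cong) (auto simp: prob i(2))
    also have "\<dots> = 0" using code i(1) by (simp add: zero_error_code_def)
    finally have "(\<Sum>j\<in>{j \<in> {1..k}. g j \<noteq> i}. (M j *\<^sub>v v) \<bullet>c v) = 0" .
    then have "\<forall>j\<in>{j \<in> {1..k}. g j \<noteq> i}. (M j *\<^sub>v v) \<bullet>c v = 0"
      by (subst (asm) sum_nonneg_eq_0_iff) (use M v in \<open>auto simp: pos_semidef_def\<close>)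
    with j show ?thesis by blast
  qed
  \<comment> \<open>\<open>g j\<close> differs from \<open>a\<close> or from \<open>b\<close>, so
    one of the two instances of \<open>zero\<close> applies.\<close>
  have "(M j *\<^sub>v v) \<bullet>c v = 0" if "j \<in> {1..k}" for j
    using zero[OF a refl that] zero[OF b eq[symmetric] that] ne by metis
  then show False using povm_quadratic_sum[OF povm v(1)] v(2) by simp
qed

text \<open>\<open>Max\<close> dominates its members only on a finite set, so even this lower bound
  needs an upper bound on the achievable message numbers. Injectivity of the encoding supplies it:
  there are finitely many tensor states over a finite alphabet.\<close>

lemma max_messages_ge:
  assumes fin: "finite S"
    and pure: "\<And>\<sigma>. \<sigma> \<in> tensor_states S n \<Longrightarrow>
      \<exists>v \<in> carrier_vec (d ^ n). v \<bullet>c v = 1 \<and> channel_power d E n \<sigma> = pure_state v"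
    and code: "zero_error_code d E S m n f k M g"
  shows "m \<le> max_messages d E S n"
proof -
  have "tensor_states S n = kron_list ` {\<rho>s. set \<rho>s \<subseteq> S \<and> length \<rho>s = n}"
    by (auto simp: tensor_states_def)
  then have fin_tensor: "finite (tensor_states S n)"
    using finite_lists_length_eq[OF fin] by simp
  have "l \<le> card (tensor_states S n)" if c: "zero_error_code d E S l n f' k' M' g'"
    for l f' k' M' g'
  proof -
    have "f' ` {1..l} \<subseteq> tensor_states S n" using c by (auto simp: zero_error_code_def)
    from card_inj_on_le[OF zero_error_code_inj[OF c pure] this fin_tensor] show ?thesis by simp
  qed
  then have "{l. \<exists>f k M g. zero_error_code d E S l n f k M g} \<subseteq> {..card (tensor_states S n)}"
    by auto
  then have "finite {l. \<exists>f k M g. zero_error_code d E S l n f k M g}"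
    by (rule finite_subset) simp
  then show ?thesis unfolding max_messages_def using code by (intro Max_ge) auto
qed

text \<open>The measurement asks whether the output is along \<open>v\<close>. Outcome 2 is
  impossible on \<open>v\<close>, and outcome 1 is impossible on \<open>w\<close> by orthogonality,
  so the outcome is itself the message.\<close>

lemma orthogonal_pure_states_code:
  assumes q: "quantum_channel d E \<kappa> A"
    and v: "v \<in> carrier_vec d" "v \<bullet>c v = 1" "E (pure_state v) = pure_state v"
    and w: "w \<in> carrier_vec d" "w \<bullet>c w = 1" "E (pure_state w) = pure_state w"
    and orth: "w \<bullet>c v = 0"
  shows "zero_error_code d E {pure_state v, pure_state w} 2 1
    (\<lambda>i. if i = 1 then pure_state v else pure_state w) 2
    (\<lambda>j. if j = 1 then pure_state v else 1\<^sub>m d - pure_state v) id"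
proof -
  have two: "{1..2} = {1, 2 :: nat}" by auto
  note ch = channel_power_one[OF q pure_state_carrier[OF v(1)]]
    channel_power_one[OF q pure_state_carrier[OF w(1)]]
  have "sum_of_mats d (\<lambda>j. if j = 1 then pure_state v else 1\<^sub>m d - pure_state v) {1..2 :: nat} = 1\<^sub>m d"
    using pure_state_carrier[OF v(1)] by (intro eq_matI) (auto simp: sum_of_mats_def two simp del: One_nat_def)
  then have "povm d 2 (\<lambda>j. if j = 1 then pure_state v else 1\<^sub>m d - pure_state v)"
    using v by (simp add: povm_def pos_semidef_pure_state pos_semidef_one_minus_pure_state)
  moreover have "(1\<^sub>m d - pure_state v) *\<^sub>v v = 0\<^sub>v d"
    using v by (simp add: minus_mult_distrib_mat_vec[of _ d d] pure_state_mult_vec[of _ d])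
  then have "mat_trace (pure_state v * (1\<^sub>m d - pure_state v)) = 0"
    using v mat_trace_pure_state_mult[OF v(1), of "1\<^sub>m d - pure_state v"]
    by (simp only: minus_carrier_mat pure_state_carrier scalar_prod_left_zero carrier_vec_conjugate)
  moreover have "mat_trace (pure_state w * pure_state v) = 0"
    using v w orth by (simp add: mat_trace_pure_state_mult[of _ d] pure_state_mult_vec[of _ d])
  \<comment> \<open>Each message has exactly one wrong outcome, the other number, so the error
    condition becomes one vanishing trace per message.\<close>
  moreover have "{j \<in> {1..2}. id j \<noteq> i} = {3 - i}" if "i \<in> {1..2}" for i :: nat
    using that by auto presburger
  ultimately show ?thesis
    using ch v w unfolding zero_error_code_def tensor_states_one
    by (auto simp: two outcome_prob_def simp del: One_nat_def)
qed

theorem mainTheorem2: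
  fixes d \<kappa> :: nat
    and E :: "complex mat \<Rightarrow> complex mat"
    and A :: "nat \<Rightarrow> complex mat"
    and \<psi> \<phi> :: "complex vec"
    and \<nu> \<mu> :: "nat \<Rightarrow> complex"
  assumes channel: "quantum_channel d E \<kappa> A"
    and unit_\<psi>: "\<psi> \<in> carrier_vec d" "\<psi> \<bullet>c \<psi> = 1"
    and unit_\<phi>: "\<phi> \<in> carrier_vec d" "\<phi> \<bullet>c \<phi> = 1"
    and not_multiples: "\<not> (\<exists>z. \<phi> = z \<cdot>\<^sub>v \<psi>)" "\<not> (\<exists>z. \<psi> = z \<cdot>\<^sub>v \<phi>)"
    and eigen_\<psi>: "\<And>i. i \<in> {1..\<kappa>} \<Longrightarrow> A i *\<^sub>v \<psi> = \<nu> i \<cdot>\<^sub>v \<psi>"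
    and eigen_\<phi>: "\<And>i. i \<in> {1..\<kappa>} \<Longrightarrow> A i *\<^sub>v \<phi> = \<mu> i \<cdot>\<^sub>v \<phi>"
  shows "zero_error_capacity d E > 0"
proof -
  obtain \<chi> where \<chi>: "\<chi> \<in> carrier_vec d" "\<chi> \<bullet>c \<chi> = 1" "\<chi> \<bullet>c \<psi> = 0"
    and eigen_\<chi>: "\<And>i. i \<in> {1..\<kappa>} \<Longrightarrow> A i *\<^sub>v \<chi> = \<mu> i \<cdot>\<^sub>v \<chi>"
    using exists_orthogonal_common_eigenvector[OF channel unit_\<psi> unit_\<phi> not_multiples(1)
      eigen_\<psi> eigen_\<phi>] by blast
  note fix_\<psi> = quantum_channel_fixes_common_eigenstate[OF channel unit_\<psi> eigen_\<psi>]
  note fix_\<chi> = quantum_channel_fixes_common_eigenstate[OF channel \<chi>(1,2) eigen_\<chi>]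
  \<comment> \<open>The alphabet uses \<open>\<chi>\<close> in place of \<open>\<phi>\<close>: the
    measurement separates the letters without error because they are orthogonal.\<close>
  define S where "S = {pure_state \<psi>, pure_state \<chi>}"
  have S: "S \<in> {S. finite S \<and> S \<noteq> {} \<and> S \<subseteq> density_ops d}"
    using unit_\<psi> \<chi> by (simp add: S_def pure_state_in_density_ops)
  have "2 \<le> max_messages d E S 1"
  proof (rule max_messages_ge)
    show "\<exists>v \<in> carrier_vec (d ^ 1). v \<bullet>c v = 1 \<and> channel_power d E 1 \<sigma> = pure_state v"
      if "\<sigma> \<in> tensor_states S 1" for \<sigma>
    proof -
      have "\<sigma> = pure_state \<psi> \<or> \<sigma> = pure_state \<chi>"
        using that unfolding tensor_states_one S_def by blast
      then show ?thesis
        using unit_\<psi> \<chi> fix_\<psi> fix_\<chi> channel_power_one[OF channel, of \<sigma>]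
        by (auto simp del: One_nat_def)
    qed
    show "zero_error_code d E S 2 1 (\<lambda>i. if i = 1 then pure_state \<psi> else pure_state \<chi>) 2
        (\<lambda>j. if j = 1 then pure_state \<psi> else 1\<^sub>m d - pure_state \<psi>) id"
      unfolding S_def
      by (rule orthogonal_pure_states_code[OF channel unit_\<psi> fix_\<psi> \<chi>(1,2) fix_\<chi> \<chi>(3)])
  qed (simp add: S_def)
  \<comment> \<open>At block length one, two messages already give a rate of at least
    \<open>log 2 2 = 1\<close>; both suprema dominate this single value.\<close>
  then have "0 < ereal (1 / real 1 * log 2 (real (max_messages d E S 1)))" by simp
  also have "\<dots> \<le> (SUP n \<in> {1..}. ereal (1 / real n * log 2 (real (max_messages d E S n))))"
    by (rule SUP_upper) simp
  also have "\<dots> \<le> zero_error_capacity d E"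
    unfolding zero_error_capacity_def by (rule SUP_upper[OF S])
  finally show ?thesis .
qed

end
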